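(* Let $\mathbf{CMet}$ be the category whose objects are non-empty $1$-bounded complete metric spaces and whose morphisms are non-expansive maps. For all $r,s\in[0,\infty]$ and objects $A,B$ of $\mathbf{CMet}$ there are natural transformations of the following types: \begin{align*} m_{r,A,B} &\colon r A \otimes r B \to r (A \otimes B), & n_{r} &\colon \mathbf{1} \to r \mathbf{1},\\ c_{r,s,A} &\colon (r+s) A \to r A \otimes s A, & w_A &\colon 0 A \to \mathbf{1},\\ a_{r,s,A} &\colon (rs) A \to r (s A), & \epsilon_A &\colon 1 A \to A,\\ \kappa_{r,s,A} &\colon s A \to r A \quad \text{(for $r \leq s$)}. \end{align*} Moreover: \begin{itemize} \item When $r,s \neq 0$, the underlying map of $c_{r,s,A}$ is the diagonal $a\mapsto (a,a)$; the underlying maps of all the other maps are identities. \item When $r=0$, $c_{r,s,A}$ is the left unitor; $m_{r,A,B}$ and $\kappa_{r,s,A}$ are the constant map to $\mathbf{1}$. \item If $s\leq 1$ or $r \geq 1$ then $a_{r,s,A}$ is an isomorphism. \item If $r\geq 1$ then $m_{r,A,B}$ is an isomorphism. \end{itemize}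
   Context: A ($1$-bounded) metric space is a set $X$ with $d_X\colon X\times X\to[0,1]$ satisfying $d_X(x,y)=0$ iff $x=y$, symmetry and the triangle inequality; a map $f$ is non-expansive if $d_Y(f(x),f(x'))\le d_X(x,x')$. $\mathbf{1}$ denotes the one-point metric space. The tensor $X\otimes Y$ is the Cartesian product $X\times Y$ with distance $d_{X\otimes Y}((x,y),(x',y'))=\min\{d_X(x,x')+d_Y(y,y'),1\}$; with unit $\mathbf{1}$ it makes $\mathbf{CMet}$ symmetric monoidal (unitors, associators from the set-theoretic ones). For $r\in(0,\infty)$, the rescaled space $rX$ has the same underlying set as $X$ and distance $d_{rX}(x,x')=\min\{r\cdot d_X(x,x'),1\}$; $0X$ is defined to be $\mathbf{1}$, and $\infty X$ is the discrete metric space on the underlying set of $X$ (all distinct points at distance $1$). Rescaling is a functor (identity on underlying maps, or constant for $r=0$). Arithmetic on $[0,\infty]$ is the usual ordered semiring with $\infty\cdot 0=0\cdot\infty=0$. *)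

theory Defs
  imports "HOL-Analysis.Analysis"
begin

section \<open>Categories, functors and natural transformations\<close>

record ('o, 'm) cat =
  Ob :: "'o set"
  Ar :: "'m set"
  Dom :: "'m \<Rightarrow> 'o"
  Cod :: "'m \<Rightarrow> 'o"
  Ident :: "'o \<Rightarrow> 'm"
  Comp :: "'m \<Rightarrow> 'm \<Rightarrow> 'm"  \<comment> \<open>\<open>Comp C g f\<close> is \<open>g\<close> after \<open>f\<close>\<close>

definition hom :: "('o, 'm) cat \<Rightarrow> 'o \<Rightarrow> 'o \<Rightarrow> 'm set" where
  "hom C X Y = {f \<in> Ar C. Dom C f = X \<and> Cod C f = Y}"

locale category =
  fixes C :: "('o, 'm) cat"
  assumes Dom_in_Ob: "f \<in> Ar C \<Longrightarrow> Dom C f \<in> Ob C"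
    and Cod_in_Ob: "f \<in> Ar C \<Longrightarrow> Cod C f \<in> Ob C"
    and Ident_in_hom: "X \<in> Ob C \<Longrightarrow> Ident C X \<in> hom C X X"
    and Comp_in_hom: "f \<in> hom C X Y \<Longrightarrow> g \<in> hom C Y Z \<Longrightarrow> Comp C g f \<in> hom C X Z"
    and Comp_Ident: "f \<in> hom C X Y \<Longrightarrow> Comp C f (Ident C X) = f"
    and Ident_Comp: "f \<in> hom C X Y \<Longrightarrow> Comp C (Ident C Y) f = f"
    and Comp_assoc: "f \<in> hom C W X \<Longrightarrow> g \<in> hom C X Y \<Longrightarrow> h \<in> hom C Y Z \<Longrightarrow>
      Comp C h (Comp C g f) = Comp C (Comp C h g) f"

definition inverse_arrows :: "('o, 'm) cat \<Rightarrow> 'm \<Rightarrow> 'm \<Rightarrow> bool" where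
  "inverse_arrows C f g \<longleftrightarrow>
     f \<in> Ar C \<and> g \<in> hom C (Cod C f) (Dom C f) \<and>
     Comp C g f = Ident C (Dom C f) \<and> Comp C f g = Ident C (Cod C f)"

definition isomorphism :: "('o, 'm) cat \<Rightarrow> 'm \<Rightarrow> bool" where
  "isomorphism C f \<longleftrightarrow> (\<exists>g. inverse_arrows C f g)"

definition prod_cat :: "('o, 'm) cat \<Rightarrow> ('p, 'n) cat \<Rightarrow> ('o \<times> 'p, 'm \<times> 'n) cat" where
  "prod_cat C D =
     \<lparr>Ob = Ob C \<times> Ob D, Ar = Ar C \<times> Ar D,
      Dom = map_prod (Dom C) (Dom D), Cod = map_prod (Cod C) (Cod D),
      Ident = map_prod (Ident C) (Ident D),
      Comp = (\<lambda>g f. (Comp C (fst g) (fst f), Comp D (snd g) (snd f)))\<rparr>"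

record ('o, 'm, 'p, 'n) ftor =
  on_ob :: "'o \<Rightarrow> 'p"
  on_ar :: "'m \<Rightarrow> 'n"

locale is_functor = C: category C + D: category D
  for C :: "('o, 'm) cat" and D :: "('p, 'n) cat" +
  fixes F :: "('o, 'm, 'p, 'n) ftor"
  assumes on_ob_in_Ob: "X \<in> Ob C \<Longrightarrow> on_ob F X \<in> Ob D"
    and on_ar_in_hom: "f \<in> hom C X Y \<Longrightarrow> on_ar F f \<in> hom D (on_ob F X) (on_ob F Y)"
    and on_ar_Ident: "X \<in> Ob C \<Longrightarrow> on_ar F (Ident C X) = Ident D (on_ob F X)"
    and on_ar_Comp: "f \<in> hom C X Y \<Longrightarrow> g \<in> hom C Y Z \<Longrightarrow>
      on_ar F (Comp C g f) = Comp D (on_ar F g) (on_ar F f)"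

locale nat_trans = F: is_functor C D F + G: is_functor C D G
  for C :: "('o, 'm) cat" and D :: "('p, 'n) cat"
    and F :: "('o, 'm, 'p, 'n) ftor" and G :: "('o, 'm, 'p, 'n) ftor" +
  fixes \<tau> :: "'o \<Rightarrow> 'n"
  assumes component_in_hom: "X \<in> Ob C \<Longrightarrow> \<tau> X \<in> hom D (on_ob F X) (on_ob G X)"
    and naturality: "f \<in> hom C X Y \<Longrightarrow> Comp D (\<tau> Y) (on_ar F f) = Comp D (on_ar G f) (\<tau> X)"

definition id_ftor :: "('o, 'm, 'o, 'm) ftor" where
  "id_ftor = \<lparr>on_ob = (\<lambda>X. X), on_ar = (\<lambda>f. f)\<rparr>"

definition const_ftor :: "('p, 'n) cat \<Rightarrow> 'p \<Rightarrow> ('o, 'm, 'p, 'n) ftor" where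
  "const_ftor D Y = \<lparr>on_ob = (\<lambda>_. Y), on_ar = (\<lambda>_. Ident D Y)\<rparr>"

definition comp_ftor ::
    "('p, 'n, 'q, 'k) ftor \<Rightarrow> ('o, 'm, 'p, 'n) ftor \<Rightarrow> ('o, 'm, 'q, 'k) ftor"
    (infixr \<open>\<circ>\<^sub>F\<close> 55) where
  "G \<circ>\<^sub>F F = \<lparr>on_ob = on_ob G \<circ> on_ob F, on_ar = on_ar G \<circ> on_ar F\<rparr>"

definition pair_ftor ::
    "('o, 'm, 'p, 'n) ftor \<Rightarrow> ('o, 'm, 'q, 'k) ftor \<Rightarrow> ('o, 'm, 'p \<times> 'q, 'n \<times> 'k) ftor" where
  "pair_ftor F G = \<lparr>on_ob = (\<lambda>X. (on_ob F X, on_ob G X)), on_ar = (\<lambda>f. (on_ar F f, on_ar G f))\<rparr>"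

definition prod_ftor ::
    "('o, 'm, 'p, 'n) ftor \<Rightarrow> ('o2, 'm2, 'p2, 'n2) ftor \<Rightarrow>
     ('o \<times> 'o2, 'm \<times> 'm2, 'p \<times> 'p2, 'n \<times> 'n2) ftor" where
  "prod_ftor F G = \<lparr>on_ob = map_prod (on_ob F) (on_ob G), on_ar = map_prod (on_ar F) (on_ar G)\<rparr>"


section \<open>Complete metric spaces and non-expansive maps\<close>

text \<open>
  All spaces live in one type of points that is closed under pairing and contains a distinguished
  point, so that the one-point space, tensors and rescalings are objects of a single category and
  an underlying map can literally be an identity or a diagonal. The type \<open>'a\<close> of atoms is
  arbitrary, so spaces of every cardinality occur; see \<open>CMet_contains_copies\<close> below.
\<close>

datatype 'a point = Star | Atom 'a | Pt_pair (pt_fst: "'a point") (pt_snd: "'a point")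

datatype 'a arrow =
  Arrow (src: "'a point metric") (tgt: "'a point metric") (umap: "'a point \<Rightarrow> 'a point")

definition cmet_space :: "'b metric \<Rightarrow> bool" where
  "cmet_space X \<longleftrightarrow>
     mspace X \<noteq> {} \<and> (\<forall>x\<in>mspace X. \<forall>y\<in>mspace X. mdist X x y \<le> 1) \<and> mcomplete_of X"

definition nonexpansive :: "'b metric \<Rightarrow> 'c metric \<Rightarrow> ('b \<Rightarrow> 'c) \<Rightarrow> bool" where
  "nonexpansive X Y f \<longleftrightarrow>
     f \<in> mspace X \<rightarrow> mspace Y \<and>
     (\<forall>x\<in>mspace X. \<forall>x'\<in>mspace X. mdist Y (f x) (f x') \<le> mdist X x x')"

text \<open>Underlying maps are extensional, so that equality of arrows is equality of maps on the source.\<close>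

definition CMet :: "('a point metric, 'a arrow) cat" where
  "CMet =
     \<lparr>Ob = {X. cmet_space X},
      Ar = {f. cmet_space (src f) \<and> cmet_space (tgt f) \<and>
               nonexpansive (src f) (tgt f) (umap f) \<and> umap f \<in> extensional (mspace (src f))},
      Dom = src, Cod = tgt,
      Ident = (\<lambda>X. Arrow X X (\<lambda>x\<in>mspace X. x)),
      Comp = (\<lambda>g f. Arrow (src f) (tgt g) (compose (mspace (src f)) (umap g) (umap f)))\<rparr>"

definition one_space :: "'a point metric" where
  "one_space = metric ({Star}, \<lambda>_ _. 0)"

definition tensor :: "'a point metric \<Rightarrow> 'a point metric \<Rightarrow> 'a point metric" where
  "tensor X Y = metric
     ({Pt_pair x y | x y. x \<in> mspace X \<and> y \<in> mspace Y},
      \<lambda>p q. min (mdist X (pt_fst p) (pt_fst q) + mdist Y (pt_snd p) (pt_snd q)) 1)"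

definition rescale :: "ennreal \<Rightarrow> 'a point metric \<Rightarrow> 'a point metric" where
  "rescale r X =
     (if r = 0 then one_space
      else if r = \<infinity> then metric (mspace X, discrete_metric.dd)
      else metric (mspace X, \<lambda>x y. min (enn2real r * mdist X x y) 1))"

definition tensor_ftor ::
    "('a point metric \<times> 'a point metric, 'a arrow \<times> 'a arrow, 'a point metric, 'a arrow) ftor" where
  "tensor_ftor =
     \<lparr>on_ob = (\<lambda>(X, Y). tensor X Y),
      on_ar = (\<lambda>(f, g). Arrow (tensor (src f) (src g)) (tensor (tgt f) (tgt g))
        (\<lambda>p\<in>mspace (tensor (src f) (src g)). Pt_pair (umap f (pt_fst p)) (umap g (pt_snd p))))\<rparr>"

definition rescale_ftor ::
    "ennreal \<Rightarrow> ('a point metric, 'a arrow, 'a point metric, 'a arrow) ftor" where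
  "rescale_ftor r =
     \<lparr>on_ob = rescale r,
      on_ar = (\<lambda>f. Arrow (rescale r (src f)) (rescale r (tgt f))
        (if r = 0 then (\<lambda>x\<in>{Star}. Star) else umap f))\<rparr>"

definition left_unitor :: "'a point metric \<Rightarrow> 'a arrow" where
  "left_unitor X = Arrow (tensor one_space X) X (\<lambda>p\<in>mspace (tensor one_space X). pt_snd p)"

definition identity_on_points :: "'a arrow \<Rightarrow> bool" where
  "identity_on_points f \<longleftrightarrow> (\<forall>x\<in>mspace (src f). umap f x = x)"

definition diagonal_on_points :: "'a arrow \<Rightarrow> bool" where
  "diagonal_on_points f \<longleftrightarrow> (\<forall>x\<in>mspace (src f). umap f x = Pt_pair x x)"

definition constant_to_one :: "'a arrow \<Rightarrow> bool" where
  "constant_to_one f \<longleftrightarrow> tgt f = one_space \<and> (\<forall>x\<in>mspace (src f). umap f x = Star)"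


text \<open>The pairs passed to \<open>metric\<close> above are metric spaces, so the constructions are as intended.\<close>

lemma mspace_one_space [simp]: "mspace one_space = {Star}"
  and mdist_one_space [simp]: "mdist one_space x y = 0"
proof -
  have M: "Metric_space {Star} (\<lambda>_ _. 0)" by unfold_locales auto
  show "mspace one_space = {Star}" "mdist one_space x y = 0"
    by (simp_all add: one_space_def Metric_space.mspace_metric[OF M] Metric_space.mdist_metric[OF M])
qed

lemma Metric_space_tensor:
  "Metric_space {Pt_pair x y | x y. x \<in> mspace X \<and> y \<in> mspace Y}
     (\<lambda>p q. min (mdist X (pt_fst p) (pt_fst q) + mdist Y (pt_snd p) (pt_snd q)) 1)"
proof
  fix p q r
  assume "p \<in> {Pt_pair x y | x y. x \<in> mspace X \<and> y \<in> mspace Y}"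
    "q \<in> {Pt_pair x y | x y. x \<in> mspace X \<and> y \<in> mspace Y}"
  then show "(min (mdist X (pt_fst p) (pt_fst q) + mdist Y (pt_snd p) (pt_snd q)) 1 = 0) = (p = q)"
    by (auto simp: min_def add_nonneg_eq_0_iff
        Metric_space.mdist_zero[OF Metric_space_mspace_mdist])
  assume "r \<in> {Pt_pair x y | x y. x \<in> mspace X \<and> y \<in> mspace Y}"
  then have "mdist X (pt_fst p) (pt_fst r) \<le> mdist X (pt_fst p) (pt_fst q) + mdist X (pt_fst q) (pt_fst r)"
    "mdist Y (pt_snd p) (pt_snd r) \<le> mdist Y (pt_snd p) (pt_snd q) + mdist Y (pt_snd q) (pt_snd r)"
    using \<open>p \<in> _\<close> \<open>q \<in> _\<close> by (auto intro: mdist_triangle)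
  then show "min (mdist X (pt_fst p) (pt_fst r) + mdist Y (pt_snd p) (pt_snd r)) 1
      \<le> min (mdist X (pt_fst p) (pt_fst q) + mdist Y (pt_snd p) (pt_snd q)) 1
        + min (mdist X (pt_fst q) (pt_fst r) + mdist Y (pt_snd q) (pt_snd r)) 1"
    using mdist_nonneg[of X] mdist_nonneg[of Y] by (smt (verit))
qed (auto simp: mdist_commute)

lemma mspace_tensor [simp]:
  "mspace (tensor X Y) = {Pt_pair x y | x y. x \<in> mspace X \<and> y \<in> mspace Y}"
  by (simp add: tensor_def Metric_space.mspace_metric[OF Metric_space_tensor])

lemma mdist_tensor [simp]:
  "mdist (tensor X Y) (Pt_pair x y) (Pt_pair x' y') = min (mdist X x x' + mdist Y y y') 1"
  by (simp add: tensor_def Metric_space.mdist_metric[OF Metric_space_tensor])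

lemma Metric_space_rescale:
  assumes "c > 0"
  shows "Metric_space (mspace X) (\<lambda>x y. min (c * mdist X x y) 1)"
proof
  fix x y z assume "x \<in> mspace X" "y \<in> mspace X" "z \<in> mspace X"
  then have "c * mdist X x z \<le> c * mdist X x y + c * mdist X y z"
    using assms mdist_triangle[of x X y z] by (simp flip: distrib_left)
  moreover have "0 \<le> c * mdist X x y" "0 \<le> c * mdist X y z" using assms by auto
  ultimately show "min (c * mdist X x z) 1 \<le> min (c * mdist X x y) 1 + min (c * mdist X y z) 1"
    by linarith
qed (use assms in \<open>auto simp: mdist_commute min_def
    Metric_space.mdist_zero[OF Metric_space_mspace_mdist]\<close>)

lemma rescale_zero [simp]: "rescale 0 X = one_space"
  by (simp add: rescale_def)

lemma mspace_rescale: "r \<noteq> 0 \<Longrightarrow> mspace (rescale r X) = mspace X"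
  by (simp add: rescale_def Metric_space.mspace_metric[OF metric_M_dd] enn2real_positive_iff
      less_top zero_less_iff_neq_zero Metric_space.mspace_metric[OF Metric_space_rescale])

lemma mdist_rescale:
  "0 < r \<Longrightarrow> r < \<infinity> \<Longrightarrow> mdist (rescale r X) x y = min (enn2real r * mdist X x y) 1"
  by (simp add: rescale_def enn2real_positive_iff
      Metric_space.mdist_metric[OF Metric_space_rescale])

lemma mdist_rescale_top: "mdist (rescale \<infinity> X) x y = (if x = y then 0 else 1)"
  by (simp add: rescale_def Metric_space.mdist_metric[OF metric_M_dd])
    (simp add: discrete_metric.dd_def)

lemma CMet_contains_copies:
  fixes X :: "'a metric"
  assumes "cmet_space X"
  shows "\<exists>Y \<in> Ob (CMet :: ('a point metric, 'a arrow) cat). mspace Y = Atom ` mspace X \<and>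
           (\<forall>x\<in>mspace X. \<forall>x'\<in>mspace X. mdist Y (Atom x) (Atom x') = mdist X x x')"
proof -
  define un where "un = (\<lambda>p. THE x. p = (Atom x :: 'a point))"
  have un [simp]: "un (Atom x) = x" for x by (simp add: un_def)
  define M where "M = Atom ` mspace X"
  define d where "d = (\<lambda>p q. mdist X (un p) (un q))"
  have MS: "Metric_space M d"
    by unfold_locales (auto simp: M_def d_def mdist_commute intro: mdist_triangle)
  interpret X: Metric_space "mspace X" "mdist X" by simp
  interpret Y: Metric_space M d by (fact MS)
  have "Y.mcomplete"
    unfolding Y.mcomplete_def
  proof (intro allI impI)
    fix \<sigma> :: "nat \<Rightarrow> 'a point" assume \<sigma>: "Y.MCauchy \<sigma>"
    then have rng: "\<sigma> i \<in> M" for i by (auto simp: Y.MCauchy_def)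
    have un_rng: "un (\<sigma> i) \<in> mspace X" for i using rng[of i] by (auto simp: M_def)
    have "X.MCauchy (un \<circ> \<sigma>)"
      unfolding X.MCauchy_def
    proof (intro conjI)
      show "range (un \<circ> \<sigma>) \<subseteq> mspace X" using un_rng by auto
    qed (use \<sigma>[unfolded Y.MCauchy_def] in \<open>simp add: d_def\<close>)
    then obtain x where "limitin X.mtopology (un \<circ> \<sigma>) x sequentially"
      using assms unfolding cmet_space_def mcomplete_of_def X.mcomplete_def by blast
    then have "limitin Y.mtopology \<sigma> (Atom x) sequentially"
      using rng unfolding Y.limitin_metric X.limitin_metric
      by (fastforce simp: M_def d_def elim: eventually_mono)
    then show "\<exists>y. limitin Y.mtopology \<sigma> y sequentially" by blast
  qed
  then have "cmet_space (metric (M, d))"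
    using assms by (auto simp: cmet_space_def M_def[symmetric]) (auto simp: M_def d_def)
  then show ?thesis
    by (intro bexI[of _ "metric (M, d)"]) (auto simp: CMet_def, auto simp: M_def d_def)
qed

end

theory Submission
  imports Defs
begin

text \<open>
  With distances read in \<open>[0, \<infinity>]\<close>, every rescaling, including \<open>0\<close> and \<open>\<infinity>\<close>, is given by the
  single formula \<open>min (r d) 1\<close>, and the tensor by \<open>min (d + d') 1\<close>. Non-expansiveness of each
  structure map, and isometry in the invertible cases, then become (in)equalities between truncated
  expressions in the ordered semiring \<open>[0, \<infinity>]\<close>.
\<close>

section \<open>Products and composites of functors\<close>

lemma hom_prod_cat: "hom (prod_cat C D) X Y = hom C (fst X) (fst Y) \<times> hom D (snd X) (snd Y)"
  by (auto simp: hom_def prod_cat_def prod_eq_iff)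

lemma prod_cat_simps:
  "Ob (prod_cat C D) = Ob C \<times> Ob D"
  "Ar (prod_cat C D) = Ar C \<times> Ar D"
  "Dom (prod_cat C D) p = (Dom C (fst p), Dom D (snd p))"
  "Cod (prod_cat C D) p = (Cod C (fst p), Cod D (snd p))"
  "Ident (prod_cat C D) X = (Ident C (fst X), Ident D (snd X))"
  "Comp (prod_cat C D) q p = (Comp C (fst q) (fst p), Comp D (snd q) (snd p))"
  by (simp_all add: prod_cat_def map_prod_def case_prod_beta)

text \<open>\<open>nat_trans\<close> carries functor proofs for its source and target. Since these
  are built by composing, pairing and multiplying functors, each construction has to be shown
  functorial.\<close>

lemma category_prod_cat:
  assumes "category C" "category D"
  shows "category (prod_cat C D)"
proof -
  interpret C: category C by fact
  interpret D: category D by fact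
  show ?thesis
    by unfold_locales
      (auto simp: hom_prod_cat prod_cat_simps C.Dom_in_Ob D.Dom_in_Ob C.Cod_in_Ob D.Cod_in_Ob
        C.Ident_in_hom D.Ident_in_hom C.Comp_Ident D.Comp_Ident C.Ident_Comp D.Ident_Comp
        elim: C.Comp_in_hom D.Comp_in_hom C.Comp_assoc D.Comp_assoc)
qed

lemma is_functor_id: "category C \<Longrightarrow> is_functor C C id_ftor"
  by (simp add: is_functor_def is_functor_axioms_def id_ftor_def)

lemma is_functor_const:
  assumes "category C" "category D" "Y \<in> Ob D"
  shows "is_functor C D (const_ftor D Y)"
  using assms category.Ident_in_hom[OF assms(2,3)] category.Comp_Ident[OF assms(2)]
  by (simp add: is_functor_def is_functor_axioms_def const_ftor_def)

lemma is_functor_comp: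
  assumes "is_functor C D F" "is_functor D E G"
  shows "is_functor C E (G \<circ>\<^sub>F F)"
proof -
  interpret F: is_functor C D F by fact
  interpret G: is_functor D E G by fact
  \<comment> \<open>Instantiating \<open>G.on_ar_Comp\<close> with images under \<open>F\<close>
    turns its premises into hom statements about \<open>C\<close>, which are among the
    assumptions.\<close>
  show ?thesis
    by unfold_locales
      (auto simp: comp_ftor_def F.on_ob_in_Ob G.on_ob_in_Ob F.on_ar_Ident G.on_ar_Ident
        F.on_ar_Comp G.on_ar_Comp[OF F.on_ar_in_hom F.on_ar_in_hom]
        intro: F.on_ar_in_hom G.on_ar_in_hom)
qed

lemma is_functor_pair:
  assumes "is_functor C D F" "is_functor C E G"
  shows "is_functor C (prod_cat D E) (pair_ftor F G)"
proof -
  interpret F: is_functor C D F by fact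
  interpret G: is_functor C E G by fact
  interpret P: category "prod_cat D E"
    by (rule category_prod_cat) unfold_locales
  \<comment> \<open>\<open>hom_prod_cat\<close> splits hom sets before \<open>prod_cat_def\<close>
    is unfolded, since unfolding would destroy the pattern it matches.\<close>
  show ?thesis
    by unfold_locales
      (auto simp: hom_prod_cat pair_ftor_def F.on_ar_in_hom G.on_ar_in_hom,
        auto simp: prod_cat_def F.on_ob_in_Ob G.on_ob_in_Ob F.on_ar_Ident G.on_ar_Ident
          F.on_ar_Comp G.on_ar_Comp)
qed

lemma is_functor_prod:
  assumes "is_functor C D F" "is_functor C' D' F'"
  shows "is_functor (prod_cat C C') (prod_cat D D') (prod_ftor F F')"
proof -
  interpret F: is_functor C D F by fact
  interpret F': is_functor C' D' F' by fact
  interpret P: category "prod_cat C C'"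
    by (rule category_prod_cat) unfold_locales
  interpret Q: category "prod_cat D D'"
    by (rule category_prod_cat) unfold_locales
  show ?thesis
    by unfold_locales
      (auto simp: hom_prod_cat prod_ftor_def F.on_ar_in_hom F'.on_ar_in_hom,
        auto simp: prod_cat_def F.on_ob_in_Ob F'.on_ob_in_Ob F.on_ar_Ident F'.on_ar_Ident
          F.on_ar_Comp F'.on_ar_Comp)
qed

section \<open>Extended distances\<close>

definition edist :: "'b metric \<Rightarrow> 'b \<Rightarrow> 'b \<Rightarrow> ennreal" where
  "edist X x y = ennreal (mdist X x y)"

lemma edist_le_iff: "edist Y u v \<le> edist X x y \<longleftrightarrow> mdist Y u v \<le> mdist X x y"
  by (simp add: edist_def ennreal_le_iff)

lemma nonexpansive_iff_edist:
  "nonexpansive X Y f \<longleftrightarrow> f \<in> mspace X \<rightarrow> mspace Y \<and>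
     (\<forall>x\<in>mspace X. \<forall>x'\<in>mspace X. edist Y (f x) (f x') \<le> edist X x x')"
  by (simp add: nonexpansive_def edist_le_iff)

lemma edist_le_1: "cmet_space X \<Longrightarrow> x \<in> mspace X \<Longrightarrow> y \<in> mspace X \<Longrightarrow> edist X x y \<le> 1"
  by (simp add: cmet_space_def edist_def)

lemma edist_one_space [simp]: "edist one_space x y = 0"
  by (simp add: edist_def)

lemma ennreal_min: "ennreal (min x y) = min (ennreal x) (ennreal y)"
  by (metis ennreal_leI linorder_le_cases min.absorb1 min.absorb2)

lemma edist_tensor [simp]:
  "edist (tensor X Y) (Pt_pair x y) (Pt_pair x' y') = min (edist X x x' + edist Y y y') 1"
  by (simp add: edist_def ennreal_min)

text \<open>At r = infinity the product is 0 on equal points and infinity on distinct ones, so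
  truncation yields the discrete distance. At r = 0 both sides vanish: \<open>one_space\<close>
  assigns 0 to all arguments, even to points of \<open>X\<close> other than
  \<open>Star\<close>.\<close>

lemma edist_rescale:
  assumes "x \<in> mspace X" "y \<in> mspace X"
  shows "edist (rescale r X) x y = min (r * edist X x y) 1"
proof -
  consider "r = 0" | "r = \<infinity>" | "0 < r" "r < \<infinity>"
    using less_top zero_less_iff_neq_zero by fastforce
  then show ?thesis
  proof cases
    case 2
    then show ?thesis
      using assms mdist_nonneg[of X x y] Metric_space.zero[OF Metric_space_mspace_mdist assms]
      by (auto simp: edist_def mdist_rescale_top[unfolded infinity_ennreal_def] ennreal_top_mult)
  next
    case 3
    then obtain c where "r = ennreal c" "0 < c"
      by (metis ennreal_enn2real enn2real_positive_iff infinity_ennreal_def)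
    with 3 show ?thesis
      by (simp add: edist_def mdist_rescale ennreal_min ennreal_mult)
  qed simp
qed

section \<open>The category and its functors\<close>

lemma cmet_space_one_space: "cmet_space (one_space :: 'a point metric)"
proof -
  interpret S: Metric_space "{Star :: 'a point}" "mdist one_space"
    using Metric_space_mspace_mdist[of "one_space :: 'a point metric"] by simp
  have "S.mcomplete"
    unfolding S.mcomplete_def S.limitin_metric S.MCauchy_def by (fastforce intro: always_eventually)
  then show ?thesis
    by (simp add: cmet_space_def mcomplete_of_def)
qed

text \<open>Truncation is invisible at scales below 1 and a positive factor only rescales
  tolerances, so Cauchy sequences and limits agree for the two metrics.\<close>

lemma mcomplete_rescale_finite:
  assumes "mcomplete_of X" "0 < c"
  shows "Metric_space.mcomplete (mspace X) (\<lambda>x y. min (c * mdist X x y) 1)"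
proof -
  interpret X: Metric_space "mspace X" "mdist X" by simp
  interpret R: Metric_space "mspace X" "\<lambda>x y. min (c * mdist X x y) 1"
    by (rule Metric_space_rescale) fact
  show ?thesis
    unfolding R.mcomplete_def
  proof (intro allI impI)
    fix \<sigma> assume \<sigma>: "R.MCauchy \<sigma>"
    have "X.MCauchy \<sigma>"
      unfolding X.MCauchy_def
    proof (intro conjI allI impI)
      fix \<epsilon> :: real assume "0 < \<epsilon>"
      \<comment> \<open>A truncated distance below this tolerance is below 1, hence equals the
        untruncated one.\<close>
      with \<open>0 < c\<close> have "0 < min (c * \<epsilon>) 1" by simp
      then obtain N where "\<And>n n'. N \<le> n \<Longrightarrow> N \<le> n' \<Longrightarrow>
          min (c * mdist X (\<sigma> n) (\<sigma> n')) 1 < min (c * \<epsilon>) 1"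
        using \<sigma> unfolding R.MCauchy_def by meson
      then have "c * mdist X (\<sigma> n) (\<sigma> n') < c * \<epsilon>" if "N \<le> n" "N \<le> n'" for n n'
        using that by fastforce
      then show "\<exists>N. \<forall>n n'. N \<le> n \<longrightarrow> N \<le> n' \<longrightarrow> mdist X (\<sigma> n) (\<sigma> n') < \<epsilon>"
        using \<open>0 < c\<close> by auto
    qed (use \<sigma> in \<open>simp add: R.MCauchy_def\<close>)
    then obtain x where x: "limitin X.mtopology \<sigma> x sequentially"
      using assms unfolding mcomplete_of_def X.mcomplete_def by blast
    have "limitin R.mtopology \<sigma> x sequentially"
      unfolding R.limitin_metric
    proof (intro conjI allI impI)
      fix \<epsilon> :: real assume "0 < \<epsilon>"
      then have "\<forall>\<^sub>F n in sequentially. \<sigma> n \<in> mspace X \<and> mdist X (\<sigma> n) x < \<epsilon> / c"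
        using x \<open>0 < c\<close> unfolding X.limitin_metric by simp
      then show "\<forall>\<^sub>F n in sequentially. \<sigma> n \<in> mspace X \<and> min (c * mdist X (\<sigma> n) x) 1 < \<epsilon>"
        by eventually_elim (use \<open>0 < c\<close> in \<open>auto simp: field_simps min_less_iff_disj\<close>)
    qed (use x in \<open>simp add: X.limitin_metric\<close>)
    then show "\<exists>x. limitin R.mtopology \<sigma> x sequentially" by blast
  qed
qed

lemma cmet_space_rescale:
  assumes "cmet_space X"
  shows "cmet_space (rescale r X)"
proof (cases "r = 0")
  case False
  have "mcomplete_of (rescale r X)"
  proof (cases "r = \<infinity>")
    case True
    then show ?thesis
      by (simp add: rescale_def mcomplete_of_def Metric_space.mspace_metric[OF metric_M_dd]
          Metric_space.mdist_metric[OF metric_M_dd] discrete_metric.mcomplete_discrete_metric)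
  next
    case inf: False
    with False have "0 < enn2real r"
      by (simp add: enn2real_positive_iff less_top zero_less_iff_neq_zero)
    with False inf show ?thesis
      using mcomplete_rescale_finite[of X "enn2real r"] assms
      by (simp add: cmet_space_def rescale_def mcomplete_of_def
          Metric_space.mspace_metric[OF Metric_space_rescale]
          Metric_space.mdist_metric[OF Metric_space_rescale])
  qed
  moreover have "mdist (rescale r X) x y \<le> 1" if "x \<in> mspace X" "y \<in> mspace X" for x y
    using edist_rescale[OF that, of r] by (metis edist_def ennreal_le_1 min.cobounded2)
  ultimately show ?thesis
    using assms False by (simp add: cmet_space_def mspace_rescale)
qed (simp add: cmet_space_one_space)

text \<open>A Cauchy sequence of pairs is Cauchy in each coordinate, and the pair of the coordinate
  limits is its limit.\<close>

lemma cmet_space_tensor: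
  assumes "cmet_space X" "cmet_space Y"
  shows "cmet_space (tensor X Y)"
proof -
  interpret X: Metric_space "mspace X" "mdist X" by simp
  interpret Y: Metric_space "mspace Y" "mdist Y" by simp
  interpret T: Metric_space "mspace (tensor X Y)" "mdist (tensor X Y)"
    by (rule Metric_space_mspace_mdist)
  \<comment> \<open>Presents a point as an explicit pair, the form that \<open>mdist_tensor\<close>
    matches. It serves again for the bound by 1 at the end.\<close>
  have pair: "p = Pt_pair (pt_fst p) (pt_snd p) \<and> pt_fst p \<in> mspace X \<and> pt_snd p \<in> mspace Y"
    if "p \<in> mspace (tensor X Y)" for p
    using that by auto
  have "T.mcomplete"
    unfolding T.mcomplete_def
  proof (intro allI impI)
    fix \<sigma> assume \<sigma>: "T.MCauchy \<sigma>"
    define f where "f = pt_fst \<circ> \<sigma>"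
    define g where "g = pt_snd \<circ> \<sigma>"
    have \<sigma>_eq: "\<sigma> n = Pt_pair (f n) (g n)" and fX: "f n \<in> mspace X" and gY: "g n \<in> mspace Y" for n
      using pair[of "\<sigma> n"] \<sigma> by (auto simp: T.MCauchy_def f_def g_def simp del: mspace_tensor)
    have close: "\<exists>N. \<forall>n n'. N \<le> n \<longrightarrow> N \<le> n' \<longrightarrow>
        mdist X (f n) (f n') < \<epsilon> \<and> mdist Y (g n) (g n') < \<epsilon>" if "0 < \<epsilon>" for \<epsilon> :: real
    proof -
      \<comment> \<open>Capping the tolerance at 1 disables the truncation; the sum then bounds both
        of its nonnegative summands.\<close>
      have "0 < min \<epsilon> 1" using that by simp
      then obtain N where N: "\<And>n n'. N \<le> n \<Longrightarrow> N \<le> n' \<Longrightarrow>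
          mdist (tensor X Y) (\<sigma> n) (\<sigma> n') < min \<epsilon> 1"
        using \<sigma> unfolding T.MCauchy_def by meson
      have "mdist X (f n) (f n') < \<epsilon> \<and> mdist Y (g n) (g n') < \<epsilon>" if "N \<le> n" "N \<le> n'" for n n'
        using N[OF that] mdist_nonneg[of X "f n" "f n'"] mdist_nonneg[of Y "g n" "g n'"]
        unfolding \<sigma>_eq mdist_tensor by linarith
      then show ?thesis by blast
    qed
    have "X.MCauchy f"
      unfolding X.MCauchy_def using fX close by blast
    then obtain x where x: "limitin X.mtopology f x sequentially"
      using assms unfolding cmet_space_def mcomplete_of_def X.mcomplete_def by blast
    have "Y.MCauchy g"
      unfolding Y.MCauchy_def using gY close by blast
    then obtain y where y: "limitin Y.mtopology g y sequentially"
      using assms unfolding cmet_space_def mcomplete_of_def Y.mcomplete_def by blast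
    have "limitin T.mtopology \<sigma> (Pt_pair x y) sequentially"
      unfolding T.limitin_metric
    proof (intro conjI allI impI)
      fix \<epsilon> :: real assume "0 < \<epsilon>"
      then have "0 < \<epsilon> / 2" by simp
      then have "\<forall>\<^sub>F n in sequentially. f n \<in> mspace X \<and> mdist X (f n) x < \<epsilon> / 2"
        "\<forall>\<^sub>F n in sequentially. g n \<in> mspace Y \<and> mdist Y (g n) y < \<epsilon> / 2"
        using x y unfolding X.limitin_metric Y.limitin_metric by blast+
      then show "\<forall>\<^sub>F n in sequentially. \<sigma> n \<in> mspace (tensor X Y) \<and>
          mdist (tensor X Y) (\<sigma> n) (Pt_pair x y) < \<epsilon>"
        by eventually_elim (auto simp: \<sigma>_eq min_less_iff_disj)
    qed (use x y in \<open>simp add: X.limitin_metric Y.limitin_metric\<close>)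
    then show "\<exists>p. limitin T.mtopology \<sigma> p sequentially" by blast
  qed
  moreover have "mspace (tensor X Y) \<noteq> {}"
    using assms by (auto simp: cmet_space_def)
  ultimately show ?thesis
    by (auto simp: cmet_space_def mcomplete_of_def simp del: mspace_tensor dest!: pair)
      (metis mdist_tensor min.cobounded2)
qed

section \<open>Complete metric spaces as a category\<close>

lemma Ob_CMet [simp]: "X \<in> Ob CMet \<longleftrightarrow> cmet_space X"
  by (simp add: CMet_def)

lemma Ident_CMet [simp]: "Ident CMet X = Arrow X X (\<lambda>x\<in>mspace X. x)"
  by (simp add: CMet_def)

lemma Comp_CMet [simp]:
  "Comp CMet g f = Arrow (src f) (tgt g) (compose (mspace (src f)) (umap g) (umap f))"
  by (simp add: CMet_def)

lemma hom_CMet: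
  "f \<in> hom CMet X Y \<longleftrightarrow> src f = X \<and> tgt f = Y \<and> cmet_space X \<and> cmet_space Y \<and>
     nonexpansive X Y (umap f) \<and> umap f \<in> extensional (mspace X)"
  by (auto simp: CMet_def hom_def)

lemma nonexpansive_restrict [simp]: "nonexpansive X Y (restrict u (mspace X)) \<longleftrightarrow> nonexpansive X Y u"
  by (auto simp: nonexpansive_def Pi_iff)

lemma nonexpansive_compose:
  assumes "nonexpansive X Y f" "nonexpansive Y Z g"
  shows "nonexpansive X Z (compose (mspace X) g f)"
  using assms unfolding nonexpansive_def
  by (simp add: compose_def Pi_iff) (meson order_trans)

text \<open>Extensionality fixes the values of underlying maps off the carrier, so only points of
  the source need comparing.\<close>

lemma arrow_eqI:
  assumes "src f = src g" "tgt f = tgt g" "umap f \<in> extensional (mspace (src g))"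
    "umap g \<in> extensional (mspace (src g))" "\<And>x. x \<in> mspace (src g) \<Longrightarrow> umap f x = umap g x"
  shows "f = g"
  using assms by (intro arrow.expand) (auto intro: extensionalityI)

lemma category_CMet: "category CMet"
proof
  show "Dom CMet f \<in> Ob CMet" "Cod CMet f \<in> Ob CMet" if "f \<in> Ar CMet" for f :: "'a arrow"
    using that by (auto simp: CMet_def)
  show "Ident CMet X \<in> hom CMet X X" if "X \<in> Ob CMet" for X :: "'a point metric"
    using that by (simp add: hom_CMet) (simp add: nonexpansive_def)
  show "Comp CMet g f \<in> hom CMet X Z" if "f \<in> hom CMet X Y" "g \<in> hom CMet Y Z"
    for f g :: "'a arrow" and X Y Z
    using that by (auto simp: hom_CMet nonexpansive_compose)
  show "Comp CMet f (Ident CMet X) = f" "Comp CMet (Ident CMet Y) f = f" if "f \<in> hom CMet X Y"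
    for f :: "'a arrow" and X Y
    using that by (auto simp: hom_CMet nonexpansive_def compose_def Pi_iff intro!: arrow_eqI)
  show "Comp CMet h (Comp CMet g f) = Comp CMet (Comp CMet h g) f"
    if "f \<in> hom CMet W X" "g \<in> hom CMet X Y" "h \<in> hom CMet Y Z"
    for f g h :: "'a arrow" and W X Y Z
    using that by (auto simp: hom_CMet nonexpansive_def compose_def Pi_iff intro!: arrow_eqI)
qed

section \<open>Rescaling as a functor\<close>

lemma on_ob_rescale_ftor [simp]: "on_ob (rescale_ftor r) = rescale r"
  by (simp add: rescale_ftor_def)

lemma src_tgt_rescale_ftor [simp]:
  "src (on_ar (rescale_ftor r) f) = rescale r (src f)"
  "tgt (on_ar (rescale_ftor r) f) = rescale r (tgt f)"
  by (simp_all add: rescale_ftor_def)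

lemma umap_rescale_ftor:
  "x \<in> mspace (rescale r (src f)) \<Longrightarrow>
     umap (on_ar (rescale_ftor r) f) x = (if r = 0 then Star else umap f x)"
  by (auto simp: rescale_ftor_def)

lemma rescale_ftor_extensional:
  "umap f \<in> extensional (mspace (src f)) \<Longrightarrow>
     umap (on_ar (rescale_ftor r) f) \<in> extensional (mspace (rescale r (src f)))"
  by (simp add: rescale_ftor_def mspace_rescale)

text \<open>Multiplication by r and truncation are monotone. At r = 0 the carrier becomes
  \<open>{Star}\<close>, where \<open>u\<close> need not preserve \<open>Star\<close>; the functor
  therefore uses the constant map there.\<close>

lemma nonexpansive_rescale:
  assumes "nonexpansive X Y u" "r \<noteq> 0"
  shows "nonexpansive (rescale r X) (rescale r Y) u"
  using assms
  by (auto simp: nonexpansive_iff_edist mspace_rescale edist_rescale Pi_iff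
      intro!: min.coboundedI1 mult_left_mono)

lemma is_functor_rescale: "is_functor CMet CMet (rescale_ftor r)"
proof -
  interpret category "CMet :: ('a point metric, 'a arrow) cat" by (rule category_CMet)
  let ?F = "rescale_ftor r :: ('a point metric, 'a arrow, 'a point metric, 'a arrow) ftor"
  show ?thesis
  proof
    show "on_ob ?F X \<in> Ob CMet" if "X \<in> Ob CMet" for X
      using that by (simp add: cmet_space_rescale)
    show "on_ar ?F f \<in> hom CMet (on_ob ?F X) (on_ob ?F Y)" if "f \<in> hom CMet X Y" for f X Y
    proof -
      have "nonexpansive (rescale r X) (rescale r Y) (umap (on_ar ?F f))"
        using that nonexpansive_rescale[of X Y "umap f" r]
        by (cases "r = 0") (auto simp: hom_CMet rescale_ftor_def nonexpansive_def)
      then show ?thesis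
        using that rescale_ftor_extensional[of f r] by (auto simp: hom_CMet cmet_space_rescale)
    qed
    show "on_ar ?F (Ident CMet X) = Ident CMet (on_ob ?F X)" if "X \<in> Ob CMet" for X
      by (auto simp: rescale_ftor_def mspace_rescale)
    show "on_ar ?F (Comp CMet g f) = Comp CMet (on_ar ?F g) (on_ar ?F f)"
      if "f \<in> hom CMet X Y" "g \<in> hom CMet Y Z" for f g X Y Z
      by (auto simp: rescale_ftor_def mspace_rescale compose_def fun_eq_iff)
  qed
qed

section \<open>The tensor as a functor\<close>

lemma on_ob_tensor_ftor [simp]: "on_ob tensor_ftor P = tensor (fst P) (snd P)"
  by (simp add: tensor_ftor_def case_prod_beta)

lemma src_tgt_tensor_ftor [simp]:
  "src (on_ar tensor_ftor p) = tensor (src (fst p)) (src (snd p))"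
  "tgt (on_ar tensor_ftor p) = tensor (tgt (fst p)) (tgt (snd p))"
  by (simp_all add: tensor_ftor_def case_prod_beta)

lemma umap_tensor_ftor [simp]:
  "x \<in> mspace (src (fst p)) \<Longrightarrow> y \<in> mspace (src (snd p)) \<Longrightarrow>
     umap (on_ar tensor_ftor p) (Pt_pair x y) = Pt_pair (umap (fst p) x) (umap (snd p) y)"
  by (simp add: tensor_ftor_def case_prod_beta)

lemma tensor_ftor_extensional:
  "umap (on_ar tensor_ftor p) \<in> extensional (mspace (tensor (src (fst p)) (src (snd p))))"
  by (simp add: tensor_ftor_def case_prod_beta del: mspace_tensor)

lemma is_functor_tensor: "is_functor (prod_cat CMet CMet) CMet tensor_ftor"
proof -
  interpret category "CMet :: ('a point metric, 'a arrow) cat" by (rule category_CMet)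
  let ?C = "CMet :: ('a point metric, 'a arrow) cat"
  interpret P: category "prod_cat ?C ?C"
    by (intro category_prod_cat category_CMet)
  show ?thesis
  proof
    show "on_ob tensor_ftor P \<in> Ob ?C" if "P \<in> Ob (prod_cat ?C ?C)" for P
      using that by (auto simp: prod_cat_def cmet_space_tensor)
    show "on_ar tensor_ftor p \<in> hom ?C (on_ob tensor_ftor X) (on_ob tensor_ftor Y)"
      if "p \<in> hom (prod_cat ?C ?C) X Y" for p X Y
    proof -
      \<comment> \<open>Adding the coordinatewise inequalities and truncating preserves
        them.\<close>
      have "nonexpansive (tensor (fst X) (snd X)) (tensor (fst Y) (snd Y)) (umap (on_ar tensor_ftor p))"
        using that
        by (auto simp: hom_prod_cat hom_CMet nonexpansive_iff_edist Pi_iff mem_Times_iff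
            intro!: min.coboundedI1 add_mono)
      then show ?thesis
        using that tensor_ftor_extensional[of p]
        by (auto simp: hom_prod_cat hom_CMet cmet_space_tensor mem_Times_iff simp del: mspace_tensor)
    qed
    show "on_ar tensor_ftor (Ident (prod_cat ?C ?C) X) = Ident ?C (on_ob tensor_ftor X)" for X
      by (rule arrow_eqI) (auto simp: prod_cat_def tensor_ftor_def case_prod_beta)
    show "on_ar tensor_ftor (Comp (prod_cat ?C ?C) q p) =
        Comp ?C (on_ar tensor_ftor q) (on_ar tensor_ftor p)"
      if "p \<in> hom (prod_cat ?C ?C) X Y" "q \<in> hom (prod_cat ?C ?C) Y Z" for p q X Y Z
      using that unfolding prod_cat_simps
      by (intro arrow_eqI)
        (auto simp: tensor_ftor_def case_prod_beta compose_def hom_prod_cat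
          hom_CMet mem_Times_iff nonexpansive_def Pi_iff)
  qed
qed

section \<open>Natural transformations into the category of complete metric spaces\<close>

text \<open>The restriction supplies the extensionality that arrows of \<open>CMet\<close> require,
  so a structure map can be given by a plain function on points.\<close>

definition point_arrow ::
    "'a point metric \<Rightarrow> 'a point metric \<Rightarrow> ('a point \<Rightarrow> 'a point) \<Rightarrow> 'a arrow" where
  "point_arrow X Y u = Arrow X Y (restrict u (mspace X))"

lemma point_arrow_simps [simp]:
  "src (point_arrow X Y u) = X" "tgt (point_arrow X Y u) = Y"
  "umap (point_arrow X Y u) = restrict u (mspace X)"
  by (simp_all add: point_arrow_def)

lemma point_arrow_in_hom:
  "cmet_space X \<Longrightarrow> cmet_space Y \<Longrightarrow> nonexpansive X Y u \<Longrightarrow> point_arrow X Y u \<in> hom CMet X Y"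
  by (simp add: hom_CMet)

text \<open>Reduces naturality to an equation between points: both composites are extensional on the
  same carrier, and the maps involved send carriers into carriers.\<close>

lemma nat_trans_point_arrow:
  assumes "is_functor C CMet F" "is_functor C CMet G"
    and "\<And>X. X \<in> Ob C \<Longrightarrow> nonexpansive (on_ob F X) (on_ob G X) (u X)"
    and "\<And>X Y f x. f \<in> hom C X Y \<Longrightarrow> x \<in> mspace (on_ob F X) \<Longrightarrow>
      u Y (umap (on_ar F f) x) = umap (on_ar G f) (u X x)"
    and "\<And>X. \<tau> X = point_arrow (on_ob F X) (on_ob G X) (u X)"
  shows "nat_trans C CMet F G \<tau>"
proof -
  interpret F: is_functor C CMet F by fact
  interpret G: is_functor C CMet G by fact
  show ?thesis
  proof
    fix X assume "X \<in> Ob C"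
    then show "\<tau> X \<in> hom CMet (on_ob F X) (on_ob G X)"
      using assms(3,5) F.on_ob_in_Ob G.on_ob_in_Ob by (auto intro: point_arrow_in_hom)
  next
    fix f X Y assume f: "f \<in> hom C X Y"
    then have "X \<in> Ob C" using F.C.Dom_in_Ob by (auto simp: hom_def)
    then show "Comp CMet (\<tau> Y) (on_ar F f) = Comp CMet (on_ar G f) (\<tau> X)"
      unfolding assms(5)
      using F.on_ar_in_hom[OF f] G.on_ar_in_hom[OF f] assms(4)[OF f]
      by (intro arrow_eqI) (auto simp: hom_CMet compose_def nonexpansive_def Pi_iff)
  qed
qed

text \<open>With equal carriers and equal distances the identity is non-expansive in both directions
  and is its own inverse.\<close>

lemma isomorphism_point_arrow:
  assumes "cmet_space X" "cmet_space Y" "mspace X = mspace Y"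
    and "\<And>x y. x \<in> mspace X \<Longrightarrow> y \<in> mspace X \<Longrightarrow> edist X x y = edist Y x y"
    and "\<And>x. x \<in> mspace X \<Longrightarrow> u x = x"
  shows "isomorphism CMet (point_arrow X Y u)"
proof -
  have "inverse_arrows CMet (point_arrow X Y u) (point_arrow Y X (\<lambda>x. x))"
    using assms
    by (auto simp: inverse_arrows_def hom_CMet nonexpansive_iff_edist Pi_iff compose_def
        intro!: arrow_eqI) (auto simp: CMet_def nonexpansive_iff_edist)
  then show ?thesis by (auto simp: isomorphism_def)
qed

section \<open>Truncated arithmetic\<close>

text \<open>If a summand exceeds 1, both sides equal 1; otherwise the inner truncations do nothing.
  Hence truncating the factors of a tensor beforehand loses nothing.\<close>

lemma min_add_min_1: "min (min a 1 + min b 1) 1 = min (a + b) (1 :: ennreal)"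
proof (cases "a \<le> 1 \<and> b \<le> 1")
  case False
  then have "1 \<le> a + b" "1 \<le> min a 1 + min b 1"
    by (auto simp: not_le intro: add_increasing add_increasing2 less_imp_le)
  then show ?thesis by (simp add: min_absorb2)
qed (simp add: min_absorb1)

text \<open>An inner truncation can only shrink the result. This gives non-expansiveness of
  \<open>m\<close> and \<open>a\<close> for arbitrary r.\<close>

lemma min_mult_min_1_le: "min (r * min t 1) 1 \<le> r * (t :: ennreal)"
  by (intro min.coboundedI1 mult_left_mono) auto

text \<open>Where the inner truncation acts, both products are at least r, hence at least 1, and the
  outer truncation equalizes them. For r = 1/2 and t = 2 the sides would be 1/2 and 1.\<close>

lemma min_mult_min_1:
  assumes "1 \<le> r"
  shows "min (r * min t 1) 1 = min (r * t) (1 :: ennreal)"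
proof (cases "t \<le> 1")
  case False
  then have "1 * 1 \<le> r * t" using assms by (intro mult_mono) auto
  then show ?thesis using False assms by (simp add: min_def)
qed (simp add: min_absorb1)

section \<open>The structure maps\<close>

lemma ftor_simps [simp]:
  "on_ob (H \<circ>\<^sub>F F) X = on_ob H (on_ob F X)"
  "on_ar (H \<circ>\<^sub>F F) f = on_ar H (on_ar F f)"
  "on_ob (pair_ftor F G) X = (on_ob F X, on_ob G X)"
  "on_ar (pair_ftor F G) f = (on_ar F f, on_ar G f)"
  "on_ob (prod_ftor F' G') P = (on_ob F' (fst P), on_ob G' (snd P))"
  "on_ar (prod_ftor F' G') p = (on_ar F' (fst p), on_ar G' (snd p))"
  "on_ob id_ftor Z = Z"
  "on_ar id_ftor z = z"
  "on_ob (const_ftor D Y) W = Y"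
  "on_ar (const_ftor D Y) g = Ident D Y"
  by (simp_all add: comp_ftor_def pair_ftor_def prod_ftor_def id_ftor_def const_ftor_def
      map_prod_def case_prod_beta)

lemma mspace_rescale_if: "mspace (rescale r X) = (if r = 0 then {Star} else mspace X)"
  by (simp add: mspace_rescale)

section \<open>Naturality of the structure maps\<close>

text \<open>After \<open>min_add_min_1\<close> and distributivity, the target differs from the
  source only by an inner truncation of d + d'. For r = 0 the source point is a pair of
  \<open>Star\<close>s and the target is \<open>one_space\<close>, hence the case
  distinction.\<close>

lemma natural_tensor_rescale:
  "nat_trans (prod_cat CMet CMet) CMet
     (tensor_ftor \<circ>\<^sub>F prod_ftor (rescale_ftor r) (rescale_ftor r)) (rescale_ftor r \<circ>\<^sub>F tensor_ftor)
     (\<lambda>P. point_arrow (tensor (rescale r (fst P)) (rescale r (snd P)))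
        (rescale r (tensor (fst P) (snd P))) (\<lambda>p. if r = 0 then Star else p))"
proof -
  have ne: "nonexpansive (tensor (rescale r A) (rescale r B)) (rescale r (tensor A B))
      (\<lambda>p. if r = 0 then Star else p)" for A B :: "'a point metric"
    by (cases "r = 0")
      (auto simp: nonexpansive_iff_edist mspace_rescale edist_rescale min_add_min_1
        simp flip: distrib_left
        intro: min_mult_min_1_le)
  have nat: "(if r = 0 then Star else umap (on_ar tensor_ftor
        (on_ar (rescale_ftor r) (fst f), on_ar (rescale_ftor r) (snd f))) x) =
      umap (on_ar (rescale_ftor r) (on_ar tensor_ftor f)) (if r = 0 then Star else x)"
    if "f \<in> hom (prod_cat CMet CMet) X Y" "x \<in> mspace (tensor (rescale r (fst X)) (rescale r (snd X)))"
    for f :: "'a arrow \<times> 'a arrow" and X Y x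
    using that
    by (auto simp: hom_prod_cat hom_CMet mem_Times_iff umap_rescale_ftor mspace_rescale_if)
  show ?thesis
    by (rule nat_trans_point_arrow[OF
        is_functor_comp[OF is_functor_prod[OF is_functor_rescale is_functor_rescale] is_functor_tensor]
        is_functor_comp[OF is_functor_tensor is_functor_rescale],
        where u = "\<lambda>_ p. if r = 0 then Star else p"])
      (simp_all only: on_ob_rescale_ftor on_ob_tensor_ftor ftor_simps fst_conv snd_conv ne nat)
qed

text \<open>Distributivity makes this map distance-preserving. Each coordinate whose rescaling is
  the one-point space is replaced by \<open>Star\<close>, so one formula covers the diagonal and the
  inverse left unitor.\<close>

lemma natural_rescale_add:
  "nat_trans CMet CMet (rescale_ftor (r + s))
     (tensor_ftor \<circ>\<^sub>F pair_ftor (rescale_ftor r) (rescale_ftor s))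
     (\<lambda>A. point_arrow (rescale (r + s) A) (tensor (rescale r A) (rescale s A))
        (\<lambda>x. Pt_pair (if r = 0 then Star else x) (if s = 0 then Star else x)))"
proof -
  let ?u = "\<lambda>x. Pt_pair (if r = 0 then Star else x) (if s = 0 then Star else x)"
  have ne: "nonexpansive (rescale (r + s) A) (tensor (rescale r A) (rescale s A)) ?u"
    for A :: "'a point metric"
    by (auto simp: nonexpansive_iff_edist mspace_rescale_if edist_rescale min_add_min_1 distrib_right)
  have nat: "?u (umap (on_ar (rescale_ftor (r + s)) f) x) =
      umap (on_ar tensor_ftor (on_ar (rescale_ftor r) f, on_ar (rescale_ftor s) f)) (?u x)"
    if "f \<in> hom CMet X Y" "x \<in> mspace (rescale (r + s) X)" for f :: "'a arrow" and X Y x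
    using that by (auto simp: hom_CMet umap_rescale_ftor mspace_rescale_if split: if_splits)
  show ?thesis
    by (rule nat_trans_point_arrow[OF is_functor_rescale
        is_functor_comp[OF is_functor_pair[OF is_functor_rescale is_functor_rescale] is_functor_tensor],
        where u = "\<lambda>_. ?u"])
      (simp_all only: on_ob_rescale_ftor on_ob_tensor_ftor ftor_simps fst_conv snd_conv ne nat)
qed

lemma natural_rescale_zero:
  "nat_trans CMet CMet (rescale_ftor 0) (const_ftor CMet one_space)
     (\<lambda>A. point_arrow one_space one_space (\<lambda>x. x))"
  by (rule nat_trans_point_arrow[OF is_functor_rescale
        is_functor_const[OF category_CMet category_CMet], where u = "\<lambda>_ x. x"])
    (auto simp: cmet_space_one_space nonexpansive_def umap_rescale_ftor)

text \<open>The target truncates s d before multiplying by r. If a factor is 0, both spaces have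
  carrier \<open>{Star}\<close>, also when the other is infinite, because 0 times infinity is
  0.\<close>

lemma nonexpansive_rescale_mult:
  "nonexpansive (rescale (r * s) A) (rescale r (rescale s A)) (\<lambda>x. x)"
  by (auto simp: nonexpansive_iff_edist mspace_rescale_if edist_rescale mult.assoc
      intro: min_mult_min_1_le)

lemma natural_rescale_mult:
  "nat_trans CMet CMet (rescale_ftor (r * s)) (rescale_ftor r \<circ>\<^sub>F rescale_ftor s)
     (\<lambda>A. point_arrow (rescale (r * s) A) (rescale r (rescale s A)) (\<lambda>x. x))"
proof -
  have "umap (on_ar (rescale_ftor (r * s)) f) x =
      umap (on_ar (rescale_ftor r) (on_ar (rescale_ftor s) f)) x"
    if "f \<in> hom CMet X Y" "x \<in> mspace (rescale (r * s) X)" for f :: "'a arrow" and X Y x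
    using that by (auto simp: hom_CMet umap_rescale_ftor mspace_rescale_if split: if_splits)
  then show ?thesis
    by (intro nat_trans_point_arrow[OF is_functor_rescale
          is_functor_comp[OF is_functor_rescale is_functor_rescale], where u = "\<lambda>_ x. x"])
      (simp_all add: nonexpansive_rescale_mult)
qed

text \<open>Distances in an object are at most 1, so truncating them changes nothing.\<close>

lemma natural_rescale_one:
  "nat_trans CMet CMet (rescale_ftor 1) id_ftor (\<lambda>A. point_arrow (rescale 1 A) A (\<lambda>x. x))"
proof -
  have "nonexpansive (rescale 1 A) A (\<lambda>x. x)" if "cmet_space A" for A :: "'a point metric"
    using that by (auto simp: nonexpansive_iff_edist mspace_rescale edist_rescale edist_le_1)
  then show ?thesis
    by (intro nat_trans_point_arrow[OF is_functor_rescale is_functor_id[OF category_CMet],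
          where u = "\<lambda>_ x. x"])
      (auto simp: hom_CMet umap_rescale_ftor)
qed

text \<open>Multiplication is monotone in the scalar. Naturality also uses the ordering: s = 0
  forces r = 0, so both sides are then \<open>Star\<close>.\<close>

lemma natural_rescale_mono:
  assumes "r \<le> s"
  shows "nat_trans CMet CMet (rescale_ftor s) (rescale_ftor r)
     (\<lambda>A. point_arrow (rescale s A) (rescale r A) (\<lambda>x. if r = 0 then Star else x))"
proof -
  let ?u = "\<lambda>x. if r = 0 then Star else x"
  have ne: "nonexpansive (rescale s A) (rescale r A) ?u" for A :: "'a point metric"
    using assms
    by (auto simp: nonexpansive_iff_edist mspace_rescale_if edist_rescale
        intro!: min.coboundedI1 mult_right_mono)
  have nat: "?u (umap (on_ar (rescale_ftor s) f) x) = umap (on_ar (rescale_ftor r) f) (?u x)"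
    if "f \<in> hom CMet X Y" "x \<in> mspace (rescale s X)" for f :: "'a arrow" and X Y x
    using that assms by (auto simp: hom_CMet umap_rescale_ftor mspace_rescale_if split: if_splits)
  show ?thesis
    by (rule nat_trans_point_arrow[OF is_functor_rescale is_functor_rescale, where u = "\<lambda>_. ?u"])
      (simp_all only: on_ob_rescale_ftor ne nat)
qed

section \<open>Invertible structure maps\<close>

text \<open>For s at most 1, s d stays below the inner cutoff by 1-boundedness; for r at least 1,
  the outer cutoff absorbs the inner one.\<close>

lemma isomorphism_rescale_mult:
  assumes "s \<le> 1 \<or> 1 \<le> r" "cmet_space A"
  shows "isomorphism CMet (point_arrow (rescale (r * s) A) (rescale r (rescale s A)) (\<lambda>x. x))"
proof (rule isomorphism_point_arrow)
  fix x y assume xy: "x \<in> mspace (rescale (r * s) A)" "y \<in> mspace (rescale (r * s) A)"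
  show "edist (rescale (r * s) A) x y = edist (rescale r (rescale s A)) x y"
  proof (cases "r = 0 \<or> s = 0")
    case False
    then have xy: "x \<in> mspace A" "y \<in> mspace A" using xy by (simp_all add: mspace_rescale)
    have "min (r * min (s * edist A x y) 1) 1 = min (r * (s * edist A x y)) 1"
      using assms(1)
    proof
      assume "s \<le> 1"
      then have "s * edist A x y \<le> 1 * 1"
        by (intro mult_mono edist_le_1 assms xy) auto
      then show ?thesis by (simp add: min_absorb1)
    qed (rule min_mult_min_1)
    then show ?thesis
      using False xy by (simp add: edist_rescale mspace_rescale mult.assoc)
  qed (use xy in \<open>auto simp: mspace_rescale_if edist_rescale\<close>)
qed (auto simp: assms cmet_space_rescale mspace_rescale_if)

lemma isomorphism_tensor_rescale:
  assumes "1 \<le> r" "cmet_space A" "cmet_space B"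
  shows "isomorphism CMet (point_arrow (tensor (rescale r A) (rescale r B)) (rescale r (tensor A B))
    (\<lambda>p. if r = 0 then Star else p))"
proof -
  have "r \<noteq> 0" using assms(1) by auto
  then show ?thesis
    using assms
    by (intro isomorphism_point_arrow)
      (auto simp: cmet_space_rescale cmet_space_tensor mspace_rescale edist_rescale min_add_min_1
        min_mult_min_1 distrib_left)
qed

text \<open>The one-point factor contributes distance 0, and truncation is harmless by
  1-boundedness. Constraining \<open>v\<close> only on the carrier admits the component of
  \<open>c\<close> at r = 0, whose formula branches on s.\<close>

lemma inverse_left_unitor:
  assumes "cmet_space X" "\<And>x. x \<in> mspace X \<Longrightarrow> v x = Pt_pair Star x"
  shows "inverse_arrows CMet (left_unitor X) (point_arrow X (tensor one_space X) v)"
proof -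
  have "left_unitor X \<in> hom CMet (tensor one_space X) X"
    using assms edist_le_1[OF assms(1)]
    by (auto simp: left_unitor_def hom_CMet cmet_space_tensor cmet_space_one_space
        nonexpansive_iff_edist)
  moreover have "point_arrow X (tensor one_space X) v \<in> hom CMet X (tensor one_space X)"
    using assms
    by (auto simp: hom_CMet cmet_space_tensor cmet_space_one_space nonexpansive_iff_edist)
  moreover have "Comp CMet (point_arrow X (tensor one_space X) v) (left_unitor X) =
      Ident CMet (tensor one_space X)"
    using assms(2) by (intro arrow_eqI) (auto simp: left_unitor_def compose_def)
  moreover have "Comp CMet (left_unitor X) (point_arrow X (tensor one_space X) v) = Ident CMet X"
    using assms(2) by (intro arrow_eqI) (auto simp: left_unitor_def compose_def)
  ultimately show ?thesis
    \<comment> \<open>\<open>Comp\<close> and \<open>Ident\<close> stay folded so that the facts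
      above match the clauses of \<open>inverse_arrows\<close>.\<close>
    by (auto simp: inverse_arrows_def hom_def simp del: Comp_CMet Ident_CMet mspace_tensor)
qed

text \<open>The arrow \<open>c 0 s A\<close> goes into the tensor with \<open>one_space\<close>,
  opposite to \<open>left_unitor\<close>; calling it the left unitor is therefore expressed by
  \<open>inverse_arrows\<close>.\<close>

theorem theorem2p1:
  shows "\<exists>(m :: ennreal \<Rightarrow> 'a point metric \<times> 'a point metric \<Rightarrow> 'a arrow)
     (n :: ennreal \<Rightarrow> 'a arrow)
     (c :: ennreal \<Rightarrow> ennreal \<Rightarrow> 'a point metric \<Rightarrow> 'a arrow)
     (w :: 'a point metric \<Rightarrow> 'a arrow)
     (a :: ennreal \<Rightarrow> ennreal \<Rightarrow> 'a point metric \<Rightarrow> 'a arrow)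
     (e :: 'a point metric \<Rightarrow> 'a arrow)
     (k :: ennreal \<Rightarrow> ennreal \<Rightarrow> 'a point metric \<Rightarrow> 'a arrow).
     (\<forall>r. nat_trans (prod_cat CMet CMet) CMet
            (tensor_ftor \<circ>\<^sub>F prod_ftor (rescale_ftor r) (rescale_ftor r))
            (rescale_ftor r \<circ>\<^sub>F tensor_ftor) (m r)) \<and>
     (\<forall>r. n r \<in> hom CMet one_space (rescale r one_space)) \<and>
     (\<forall>r s. nat_trans CMet CMet (rescale_ftor (r + s))
            (tensor_ftor \<circ>\<^sub>F pair_ftor (rescale_ftor r) (rescale_ftor s)) (c r s)) \<and>
     nat_trans CMet CMet (rescale_ftor 0) (const_ftor CMet one_space) w \<and>
     (\<forall>r s. nat_trans CMet CMet (rescale_ftor (r * s))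
            (rescale_ftor r \<circ>\<^sub>F rescale_ftor s) (a r s)) \<and>
     nat_trans CMet CMet (rescale_ftor 1) id_ftor e \<and>
     (\<forall>r s. r \<le> s \<longrightarrow> nat_trans CMet CMet (rescale_ftor s) (rescale_ftor r) (k r s)) \<and>
     \<comment> \<open>underlying maps for non-zero \<open>r\<close> and \<open>s\<close>\<close>
     (\<forall>r s. r \<noteq> 0 \<longrightarrow> s \<noteq> 0 \<longrightarrow>
        (\<forall>A \<in> Ob CMet. diagonal_on_points (c r s A)) \<and>
        (\<forall>A \<in> Ob CMet. \<forall>B \<in> Ob CMet. identity_on_points (m r (A, B))) \<and>
        identity_on_points (n r) \<and>
        (\<forall>A \<in> Ob CMet. identity_on_points (w A)) \<and>
        (\<forall>A \<in> Ob CMet. identity_on_points (a r s A)) \<and>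
        (\<forall>A \<in> Ob CMet. identity_on_points (e A)) \<and>
        (r \<le> s \<longrightarrow> (\<forall>A \<in> Ob CMet. identity_on_points (k r s A)))) \<and>
     \<comment> \<open>the case \<open>r = 0\<close>\<close>
     (\<forall>s. \<forall>A \<in> Ob CMet. inverse_arrows CMet (left_unitor (rescale s A)) (c 0 s A)) \<and>
     (\<forall>A \<in> Ob CMet. \<forall>B \<in> Ob CMet. constant_to_one (m 0 (A, B))) \<and>
     (\<forall>s. \<forall>A \<in> Ob CMet. constant_to_one (k 0 s A)) \<and>
     \<comment> \<open>isomorphisms\<close>
     (\<forall>r s. s \<le> 1 \<or> 1 \<le> r \<longrightarrow> (\<forall>A \<in> Ob CMet. isomorphism CMet (a r s A))) \<and>
     (\<forall>r. 1 \<le> r \<longrightarrow> (\<forall>A \<in> Ob CMet. \<forall>B \<in> Ob CMet. isomorphism CMet (m r (A, B))))"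
\<comment> \<open>The witnesses are \<open>m\<close>, \<open>n\<close>, \<open>c\<close>,
  \<open>w\<close>, \<open>a\<close>, \<open>e\<close>, \<open>k\<close> in this order. Testing
  scalars for 0 gives each family a uniform formula; \<open>w\<close> can start at
  \<open>one_space\<close> because \<open>rescale 0 A\<close> is that space.\<close>
proof (rule exI[of _ "\<lambda>r P. point_arrow (tensor (rescale r (fst P)) (rescale r (snd P)))
      (rescale r (tensor (fst P) (snd P))) (\<lambda>p. if r = 0 then Star else p)"],
    rule exI[of _ "\<lambda>r. point_arrow one_space (rescale r one_space) (\<lambda>x. x)"],
    rule exI[of _ "\<lambda>r s A. point_arrow (rescale (r + s) A) (tensor (rescale r A) (rescale s A))
      (\<lambda>x. Pt_pair (if r = 0 then Star else x) (if s = 0 then Star else x))"],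
    rule exI[of _ "\<lambda>A. point_arrow one_space one_space (\<lambda>x. x)"],
    rule exI[of _ "\<lambda>r s A. point_arrow (rescale (r * s) A) (rescale r (rescale s A)) (\<lambda>x. x)"],
    rule exI[of _ "\<lambda>A. point_arrow (rescale 1 A) A (\<lambda>x. x)"],
    rule exI[of _ "\<lambda>r s A. point_arrow (rescale s A) (rescale r A) (\<lambda>x. if r = 0 then Star else x)"],
    intro conjI allI impI ballI)
  show "point_arrow one_space (rescale r one_space) (\<lambda>x. x) \<in> hom CMet one_space (rescale r one_space)"
    for r :: ennreal
    by (intro point_arrow_in_hom cmet_space_one_space cmet_space_rescale)
      (auto simp: nonexpansive_iff_edist mspace_rescale_if edist_rescale)
  show "inverse_arrows CMet (left_unitor (rescale s A))
      (point_arrow (rescale (0 + s) A) (tensor (rescale 0 A) (rescale s A))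
        (\<lambda>x. Pt_pair (if 0 = (0 :: ennreal) then Star else x) (if s = 0 then Star else x)))"
    if "A \<in> Ob CMet" for s and A :: "'a point metric"
    \<comment> \<open>This exposes the source \<open>rescale s A\<close> and the first factor
      \<open>one_space\<close>, as in \<open>inverse_left_unitor\<close>. If s = 0, the only point
      is \<open>Star\<close>, so the second coordinate is still the point itself.\<close>
    unfolding add_0 rescale_zero using that
    by (intro inverse_left_unitor) (auto simp: cmet_space_rescale mspace_rescale_if split: if_splits)
qed (auto simp: natural_tensor_rescale natural_rescale_add natural_rescale_zero natural_rescale_mult
    natural_rescale_one natural_rescale_mono isomorphism_rescale_mult isomorphism_tensor_rescale
    diagonal_on_points_def identity_on_points_def constant_to_one_def)

end
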